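(* Let $K\subset\mathbb{R}^3$ be a non-trivial smooth knot. Then $K$ has a trisecant; that is, there exist three distinct points $a,p,b\in K$ such that $p$ lies in the interior of the line segment $\overline{ab}$.
   Context: A smooth knot is the image of a smooth embedding (injective, with nowhere vanishing derivative) $S^1\to\mathbb{R}^3$. A knot is non-trivial if no homeomorphism of $\mathbb{R}^3$ to itself sends it into a flat (affine) plane. A secant of $K$ is a line segment with two distinct endpoints in $K$; a trisecant of $K$ is a secant together with a point (the middle point) lying in both $K$ and the interior of the secant. *)

theory Defs
  imports "HOL-Analysis.Analysis"
begin

definition nth_vector_derivative :: "nat \<Rightarrow> (real \<Rightarrow> 'a::real_normed_vector) \<Rightarrow> real \<Rightarrow> 'a" where
  "nth_vector_derivative n g = ((\<lambda>f t. vector_derivative f (at t)) ^^ n) g"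

(* For an undifferentiable f, vector_derivative f is an unspecified value; this is harmless because
   differentiability is demanded at every order, starting with g itself. *)
definition smooth_curve :: "(real \<Rightarrow> 'a::real_normed_vector) \<Rightarrow> bool" where
  "smooth_curve g \<longleftrightarrow> (\<forall>n t. nth_vector_derivative n g differentiable (at t))"

(* The circle is the unit circle of the complex plane, and only the values of f there matter.
   Smoothness and the derivative of f along the circle are read off in the angular coordinate,
   t |-> cis t being a smooth local diffeomorphism of the real line onto the circle. *)
definition smooth_circle_embedding :: "(complex \<Rightarrow> real^3) \<Rightarrow> bool" where
  "smooth_circle_embedding f \<longleftrightarrow>
     inj_on f (sphere 0 1) \<and>
     smooth_curve (\<lambda>t. f (cis t)) \<and>
     (\<forall>t. vector_derivative (\<lambda>s. f (cis s)) (at t) \<noteq> 0)"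

definition smooth_knot :: "(real^3) set \<Rightarrow> bool" where
  "smooth_knot K \<longleftrightarrow> (\<exists>f. smooth_circle_embedding f \<and> K = f ` sphere 0 1)"

definition affine_plane :: "(real^3) set \<Rightarrow> bool" where
  "affine_plane P \<longleftrightarrow> affine P \<and> aff_dim P = 2"

definition nontrivial_knot :: "(real^3) set \<Rightarrow> bool" where
  "nontrivial_knot K \<longleftrightarrow>
     \<not> (\<exists>h h' P. homeomorphism UNIV UNIV h h' \<and> affine_plane P \<and> h ` K \<subseteq> P)"

end

theory Submission
  imports Defs
begin

text \<open>
  Suppose that \<open>K\<close> has no trisecant, and let \<open>p\<close> be a point of \<open>K\<close> farthest from the origin. Put
  \<open>d s = \<gamma> s - p\<close> for a parametrisation \<open>\<gamma>\<close> of \<open>K\<close> by \<open>[0, 1]\<close> that starts and ends at \<open>p\<close>. The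
  choice of \<open>p\<close> puts \<open>K - {p}\<close> in an open half-space with \<open>p\<close> on its boundary. Since there is no
  trisecant with end point \<open>p\<close>, no two vectors \<open>d s\<close> and \<open>d t\<close> with \<open>0 < s < t < 1\<close> are
  parallel. So the directions \<open>d s / |d s|\<close> trace an embedded arc on the unit sphere, whose ends are
  the two opposite tangent directions at \<open>p\<close>. Two homeomorphisms of space now flatten \<open>K\<close>.

  The first preserves every ray from \<open>p\<close>. A positive continuous function on the arc of directions
  extends to the sphere by Tietze's theorem, and scaling each ray by its value is a homeomorphism
  (\<open>homeomorphism_radial_scaling\<close>). Hence the distance from \<open>p\<close> along the curve can be prescribed
  at will, as long as it still vanishes to first order at \<open>p\<close> (\<open>radial_rescaling_of_compact_arc\<close>). It is made to
  increase linearly up to a parameter \<open>m\<close> and then to decrease linearly.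

  After this every sphere around \<open>p\<close> meets the curve in at most two points. The second homeomorphism
  preserves every sphere around \<open>p\<close>: it turns the sphere of radius \<open>\<rho>\<close> by a rotation \<open>R \<rho>\<close> that
  moves its two points into a fixed plane through \<open>p\<close> (\<open>homeomorphism_rotating_spheres\<close>). Their
  directions from \<open>p\<close> are never parallel, so \<open>R \<rho>\<close> can be chosen continuous in \<open>\<rho>\<close>; oscillation of
  \<open>R \<rho>\<close> as \<open>\<rho>\<close> tends to 0 is harmless, because the spheres shrink to a point there. Where the
  two points merge, at \<open>m\<close>, the plane through them and \<open>p\<close> converges to the one spanned by \<open>d m\<close> and the velocity at \<open>m\<close>,
  provided that these are independent; such an \<open>m\<close> exists, as otherwise the direction of \<open>d\<close>
  would be constant (\<open>exists_nonradial_velocity\<close>). So \<open>K\<close> is mapped into a plane, and is trivial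
  (\<open>fan_curve_flattens\<close>).
\<close>

unbundle cross3_syntax

section \<open>Homeomorphisms that preserve rays or spheres\<close>

lemma continuous_on_UNIV_if_linear_growth_at_0:
  fixes f :: "'a::real_normed_vector \<Rightarrow> 'b::real_normed_vector"
  assumes "continuous_on (- {0}) f" and bound: "\<And>x. norm (f x) \<le> C * norm x"
  shows "continuous_on UNIV f"
proof -
  have "isCont f x" for x
  proof (cases "x = 0")
    case True
    have f0: "f 0 = 0" using bound[of 0] by simp
    have "(f \<longlongrightarrow> 0) (at 0)"
    proof (rule Lim_null_comparison)
      show "\<forall>\<^sub>F x in at 0. norm (f x) \<le> C * norm x" using bound by simp
      have "((\<lambda>x::'a. C * norm x) \<longlongrightarrow> C * norm (0::'a)) (at 0)" by (intro tendsto_intros)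
      then show "((\<lambda>x::'a. C * norm x) \<longlongrightarrow> 0) (at 0)" by simp
    qed
    then show ?thesis using True f0 by (simp add: isCont_def)
  next
    case False
    then show ?thesis using assms(1)
      by (metis ComplI continuous_on_eq_continuous_at open_Compl closed_singleton singletonD)
  qed
  then show ?thesis by (simp add: continuous_at_imp_continuous_on)
qed

text \<open>Both maps leave directions unchanged, which makes them inverse to each other. At the origin
  continuity comes from the boundedness of \<open>L\<close> on the unit ball.\<close>

lemma homeomorphism_radial_scaling:
  fixes L :: "'a::euclidean_space \<Rightarrow> real"
  assumes L: "continuous_on UNIV L"
  shows "homeomorphism UNIV UNIV
           (\<lambda>x. exp (L (sgn x)) *\<^sub>R x) (\<lambda>x. exp (- L (sgn x)) *\<^sub>R x)"
proof -
  have cont: "continuous_on UNIV (\<lambda>x. exp (M (sgn x)) *\<^sub>R x)"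
    if M: "continuous_on UNIV M" for M :: "'a \<Rightarrow> real"
  proof -
    have "bounded (M ` cball 0 1)"
      using M by (intro compact_imp_bounded compact_continuous_image) (auto intro: continuous_on_subset)
    then obtain C where C: "\<And>x. norm x \<le> 1 \<Longrightarrow> \<bar>M x\<bar> \<le> C"
      unfolding bounded_iff by fastforce
    show ?thesis
    proof (rule continuous_on_UNIV_if_linear_growth_at_0)
      show "continuous_on (- {0}) (\<lambda>x. exp (M (sgn x)) *\<^sub>R x)"
        unfolding sgn_div_norm
        by (intro continuous_intros continuous_on_compose2[OF M]) auto
      show "norm (exp (M (sgn x)) *\<^sub>R x) \<le> exp C * norm x" for x
        using C[of "sgn x"] by (cases "x = 0") (auto simp: norm_sgn intro!: mult_right_mono)
    qed
  qed
  have sgn_exp: "sgn (exp c *\<^sub>R x) = sgn x" for c and x :: 'a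
    by (simp add: sgn_scaleR)
  show ?thesis
    unfolding homeomorphism_def
  proof (intro conjI)
    show "(\<lambda>x. exp (L (sgn x)) *\<^sub>R x) ` UNIV = UNIV"
      by (rule surjI[where f = "\<lambda>x. exp (- L (sgn x)) *\<^sub>R x"]) (simp add: sgn_exp mult_exp_exp)
    show "(\<lambda>x. exp (- L (sgn x)) *\<^sub>R x) ` UNIV = UNIV"
      by (rule surjI[where f = "\<lambda>x. exp (L (sgn x)) *\<^sub>R x"]) (simp add: sgn_exp mult_exp_exp)
  qed (use cont[OF L] cont[OF continuous_on_minus[OF L]] in
        \<open>auto simp: sgn_exp mult_exp_exp\<close>)
qed

text \<open>Norms are preserved, so the inverse can read off from the image which rotation to undo, and
  the map is continuous at the origin whatever \<open>R\<close> does near 0.\<close>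

lemma homeomorphism_rotating_spheres:
  fixes R :: "real \<Rightarrow> real^'n^'n"
  assumes R: "continuous_on {0<..} R" and orth: "\<And>\<rho>. 0 < \<rho> \<Longrightarrow> orthogonal_matrix (R \<rho>)"
  shows "homeomorphism UNIV UNIV (\<lambda>x. R (norm x) *v x) (\<lambda>x. transpose (R (norm x)) *v x)"
proof -
  have norm_eq: "norm (Q (norm x) *v x) = norm x"
    if "\<And>\<rho>. 0 < \<rho> \<Longrightarrow> orthogonal_matrix (Q \<rho>)" for Q :: "real \<Rightarrow> real^'n^'n" and x
    using that[of "norm x"] orthogonal_transformation_norm[of "(*v) (Q (norm x))"]
    by (cases "x = 0") (simp_all add: orthogonal_transformation_matrix)
  have cont: "continuous_on UNIV (\<lambda>x. Q (norm x) *v x)"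
    if Q: "continuous_on {0<..} Q" and o: "\<And>\<rho>. 0 < \<rho> \<Longrightarrow> orthogonal_matrix (Q \<rho>)"
    for Q :: "real \<Rightarrow> real^'n^'n"
  proof (rule continuous_on_UNIV_if_linear_growth_at_0)
    show "continuous_on (- {0}) (\<lambda>x. Q (norm x) *v x)"
      unfolding matrix_vector_mult_def
      by (intro continuous_intros continuous_on_compose2[OF Q]) auto
    show "norm (Q (norm x) *v x) \<le> 1 * norm x" for x
      by (simp add: norm_eq o)
  qed
  let ?T = "\<lambda>\<rho>. transpose (R \<rho>)"
  have contT: "continuous_on {0<..} ?T"
    unfolding transpose_def by (intro continuous_intros R)
  have orthT: "orthogonal_matrix (?T \<rho>)" if "0 < \<rho>" for \<rho>
    using orth[OF that] by simp
  have inv: "?T (norm x) *v (R (norm x) *v x) = x" "R (norm x) *v (?T (norm x) *v x) = x" for x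
    using orth[of "norm x"]
    by (cases "x = 0"; simp add: matrix_vector_mul_assoc orthogonal_matrix_def del: transpose_matrix_vector)+
  have F: "norm (R (norm x) *v x) = norm x" and G: "norm (?T (norm x) *v x) = norm x" for x
    using norm_eq[of R] norm_eq[of ?T] orth orthT by blast+
  show ?thesis
    unfolding homeomorphism_def
  proof (intro conjI)
    show "(\<lambda>x. R (norm x) *v x) ` UNIV = UNIV"
      by (rule surjI[where f = "\<lambda>x. ?T (norm x) *v x"]) (simp only: G inv)
    show "(\<lambda>x. ?T (norm x) *v x) ` UNIV = UNIV"
      by (rule surjI[where f = "\<lambda>x. R (norm x) *v x"]) (simp only: F inv)
  qed (use cont[OF R orth] cont[OF contT orthT] in \<open>auto simp: F G inv simp del: transpose_matrix_vector\<close>)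
qed

text \<open>By compactness the parameter is a continuous function of the direction, so the required
  logarithmic scaling factor is a continuous function on a closed set of directions, and Tietze's
  theorem extends it to all of space. The multiple \<open>c\<close> lets one treat curves that
  pass through the origin, where the direction of the curve itself is undefined.\<close>

lemma radial_rescaling_of_compact_arc:
  fixes e :: "'b::t2_space \<Rightarrow> 'a::euclidean_space"
  assumes S: "compact S" and e: "continuous_on S e" and e0: "\<And>s. s \<in> S \<Longrightarrow> e s \<noteq> 0"
    and inj: "inj_on (\<lambda>s. sgn (e s)) S"
    and \<rho>: "continuous_on S \<rho>" "\<And>s. s \<in> S \<Longrightarrow> 0 < \<rho> s"
  obtains h h' where "homeomorphism UNIV UNIV h h'"
    and "\<And>s c. s \<in> S \<Longrightarrow> 0 \<le> c \<Longrightarrow> h (c *\<^sub>R e s) = (c * \<rho> s) *\<^sub>R sgn (e s)"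
proof -
  define \<theta> where "\<theta> = (\<lambda>s. sgn (e s))"
  have cont: "continuous_on S \<theta>"
    unfolding \<theta>_def sgn_div_norm using e0 by (intro continuous_intros e) auto
  obtain \<sigma> where \<sigma>: "homeomorphism S (\<theta> ` S) \<theta> \<sigma>"
    using homeomorphism_compact[OF S cont refl] inj unfolding \<theta>_def by blast
  define q where "q = (\<lambda>s. ln (\<rho> s / norm (e s)))"
  have q: "continuous_on S q"
    unfolding q_def using e0 \<rho>(2)
    by (intro continuous_intros e \<rho>(1)) force+
  have "continuous_on (\<theta> ` S) (\<lambda>x. q (\<sigma> x))"
    using \<sigma> by (intro continuous_on_compose2[OF q]) (auto simp: homeomorphism_def)
  moreover have "closedin (top_of_set UNIV) (\<theta> ` S)"
    using compact_continuous_image[OF cont S] by (simp add: compact_imp_closed)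
  ultimately obtain L where L: "continuous_on UNIV L" "\<And>x. x \<in> \<theta> ` S \<Longrightarrow> L x = q (\<sigma> x)"
    using Tietze_unbounded[of "\<theta> ` S" "\<lambda>x. q (\<sigma> x)" UNIV] by blast
  show thesis
  proof (rule that[OF homeomorphism_radial_scaling[OF L(1)]])
    fix s and c :: real assume s: "s \<in> S" and c: "0 \<le> c"
    show "exp (L (sgn (c *\<^sub>R e s))) *\<^sub>R c *\<^sub>R e s = (c * \<rho> s) *\<^sub>R sgn (e s)"
    proof (cases "c = 0")
      case False
      have "L (sgn (e s)) = q s"
        using L(2)[of "\<theta> s"] s \<sigma> by (simp add: \<theta>_def homeomorphism_def)
      then have "exp (L (sgn (c *\<^sub>R e s))) = \<rho> s / norm (e s)"
        using False c e0[OF s] \<rho>(2)[OF s] by (simp add: sgn_scaleR q_def)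
      then show ?thesis by (simp add: sgn_div_norm divide_inverse mult_ac)
    qed simp
  qed
qed

section \<open>Curves seen from a point\<close>

lemma continuous_difference_quotient:
  fixes f :: "real \<Rightarrow> 'a::real_normed_vector"
  assumes f: "\<And>t. f differentiable (at t)" and D: "(f has_vector_derivative D) (at a)"
  shows "continuous_on UNIV (\<lambda>s. if s = a then D else (f s - f a) /\<^sub>R (s - a))"
proof -
  let ?q = "\<lambda>s. if s = a then D else (f s - f a) /\<^sub>R (s - a)"
  have "isCont ?q s" for s
  proof (cases "s = a")
    case True
    have quotient_error: "norm ((f y - f a) /\<^sub>R (y - a) - D)
        = norm ((f y - f a - (y - a) *\<^sub>R D) /\<^sub>R norm (y - a))" if "y \<noteq> a" for y
    proof -
      have "(f y - f a) /\<^sub>R (y - a) - D = (f y - f a - (y - a) *\<^sub>R D) /\<^sub>R (y - a)"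
        using that by (simp add: scaleR_diff_right)
      then show ?thesis by simp
    qed
    have "((\<lambda>s. (f s - f a) /\<^sub>R (s - a)) \<longlongrightarrow> D) (at a)"
    proof (rule Lim_transform)
      have "((\<lambda>y. ((f y - f a) - (y - a) *\<^sub>R D) /\<^sub>R norm (y - a)) \<longlongrightarrow> 0) (at a)"
        using D unfolding has_vector_derivative_def has_derivative_at'
          by (auto simp: tendsto_iff eventually_at dist_norm divide_inverse mult.commute)
      then show "((\<lambda>y. (f y - f a) /\<^sub>R (y - a) - D) \<longlongrightarrow> 0) (at a)"
        by (rule Lim_null_comparison[rotated, OF tendsto_norm_zero])
          (auto simp: eventually_at quotient_error simp del: norm_scaleR intro!: exI[of _ 1])
    qed (rule tendsto_const)
    then have "(?q \<longlongrightarrow> D) (at a)"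
      by (rule Lim_transform_eventually) (auto simp: eventually_at intro: exI[of _ 1])
    then show ?thesis using True by (simp add: isCont_def)
  next
    case False
    have "isCont f s" using f differentiable_imp_continuous_within by blast
    then have cont: "isCont (\<lambda>s. (f s - f a) /\<^sub>R (s - a)) s"
      using False by (intro continuous_intros) auto
    have eq: "\<forall>\<^sub>F x in nhds s. ?q x = (f x - f a) /\<^sub>R (x - a)"
      using False by (intro eventually_mono[OF t1_space_nhds[of s a]]) auto
    show ?thesis by (rule isCont_cong[OF eq, THEN iffD2, OF cont])
  qed
  then show ?thesis by (simp add: continuous_at_imp_continuous_on)
qed

lemma parallel_imp_scaled:
  fixes x y :: "real^3"
  assumes "x \<times> y = 0" "x \<noteq> 0"
  obtains k where "y = k *\<^sub>R x"
  using assms unfolding cross_eq_0 collinear_lemma by (metis scaleR_zero_left)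

text \<open>If the velocity were always radial, the central projection \<open>d s / (v \<bullet> d s)\<close> would have
  derivative 0.\<close>

lemma exists_nonradial_velocity:
  fixes d :: "real \<Rightarrow> real^3"
  assumes diff: "\<And>t. d differentiable (at t)"
    and v: "\<And>s. 0 < s \<Longrightarrow> s < 1 \<Longrightarrow> 0 < v \<bullet> d s"
    and indep: "\<And>s t. 0 < s \<Longrightarrow> s < t \<Longrightarrow> t < 1 \<Longrightarrow> d s \<times> d t \<noteq> 0"
  obtains m where "0 < m" "m < 1" "d m \<times> vector_derivative d (at m) \<noteq> 0"
proof (rule ccontr)
  note witness = that
  assume "\<not> thesis"
  then have radial: "d s \<times> vector_derivative d (at s) = 0" if "0 < s" "s < 1" for s
    using witness[OF that] by blast
  have "((\<lambda>s. inverse (v \<bullet> d s) *\<^sub>R d s) has_vector_derivative 0) (at s within {0<..<1})"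
    if s: "s \<in> {0<..<1}" for s
  proof -
    have pos: "0 < v \<bullet> d s" using v s by simp
    then have "d s \<noteq> 0" by auto
    then obtain k where k: "vector_derivative d (at s) = k *\<^sub>R d s"
      using radial[of s] s by (auto elim: parallel_imp_scaled)
    have "(d has_vector_derivative k *\<^sub>R d s) (at s)"
      using diff[of s] k vector_derivative_works by metis
    then have "((\<lambda>s. inverse (v \<bullet> d s) *\<^sub>R d s) has_derivative (\<lambda>h. 0)) (at s)"
      using pos unfolding has_vector_derivative_def
      by (auto intro!: derivative_eq_intros ext simp: field_simps)
    then show ?thesis
      by (auto simp: has_vector_derivative_def intro: has_derivative_at_withinI)
  qed
  then obtain c where c: "\<And>s. s \<in> {0<..<1} \<Longrightarrow> inverse (v \<bullet> d s) *\<^sub>R d s = c"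
    using has_vector_derivative_zero_constant[OF convex_real_interval(8), of 0 1] by blast
  have ray: "d s = (v \<bullet> d s) *\<^sub>R c" if "s \<in> {0<..<1}" for s
    using c[OF that] v[of s] that by auto
  have "d (1/3) \<times> d (1/2) = ((v \<bullet> d (1/3)) *\<^sub>R c) \<times> ((v \<bullet> d (1/2)) *\<^sub>R c)"
    by (intro arg_cong2[of _ _ _ _ cross3] ray) auto
  then have "d (1/3) \<times> d (1/2) = 0"
    by (simp add: cross_mult_left cross_mult_right)
  then show False using indep[of "1/3" "1/2"] by simp
qed

section \<open>Flattening a curve whose points lie in different directions\<close>

lemma continuous_on_vector_3:
  fixes a b c :: "'a::topological_space \<Rightarrow> 'b::{topological_space, zero}"
  assumes "continuous_on S a" "continuous_on S b" "continuous_on S c"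
  shows "continuous_on S (\<lambda>x. vector [a x, b x, c x] :: 'b^3)"
proof -
  have "(\<lambda>x. vector [a x, b x, c x] :: 'b^3) = (\<lambda>x. \<chi> i. if i = 1 then a x else if i = 2 then b x else c x)"
    by (auto simp: vec_eq_iff forall_3 fun_eq_iff)
  moreover have "continuous_on S (\<lambda>x. if i = 1 then a x else if i = 2 then b x else c x)" for i :: 3
    using assms by (cases "i = 1"; cases "i = 2") auto
  ultimately show ?thesis by (simp only: continuous_on_vec_lambda)
qed

lemma orthogonal_matrix_frame:
  fixes u n :: "real^3"
  assumes "norm u = 1" "norm n = 1" "u \<bullet> n = 0"
  shows "orthogonal_matrix (vector [u, n \<times> u, n] :: real^3^3)"
proof -
  have "norm (n \<times> u) = 1"
    using norm_cross_dot[of n u] assms by (simp add: inner_commute power2_eq_1_iff)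
      (smt (verit) norm_ge_zero)
  moreover have "row i A = A $ i" for i and A :: "real^3^3"
    by (simp add: row_def vec_eq_iff)
  ultimately show ?thesis
    using assms
    by (simp add: orthogonal_matrix_orthonormal_rows forall_3 orthogonal_def dot_cross_self inner_commute)
qed

text \<open>The hypotheses describe a knot through the origin that lies on one side of a supporting plane
  there and meets each line through the origin in at most one further point. The segments from the
  origin to its points form an embedded disc, so it is no surprise that the curve is unknotted;
  prescribing the distances from the origin and then rotating concentric spheres replaces any
  argument about the possibly complicated arc of directions.\<close>

lemma fan_curve_flattens:
  fixes d :: "real \<Rightarrow> real^3"
  assumes diff: "\<And>t. d differentiable (at t)"
    and D: "(d has_vector_derivative D) (at 0)" "(d has_vector_derivative D) (at 1)" "D \<noteq> 0"
    and ends: "d 0 = 0" "d 1 = 0"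
    and v: "\<And>s. 0 < s \<Longrightarrow> s < 1 \<Longrightarrow> 0 < v \<bullet> d s" "v \<bullet> D = 0"
    and indep: "\<And>s t. 0 < s \<Longrightarrow> s < t \<Longrightarrow> t < 1 \<Longrightarrow> d s \<times> d t \<noteq> 0"
  obtains h h' :: "real^3 \<Rightarrow> real^3"
  where "homeomorphism UNIV UNIV h h'" "\<And>s. s \<in> {0..1} \<Longrightarrow> h (d s) $ 3 = 0"
proof -
  \<comment> \<open>The curve is made to reach its greatest distance from the origin at parameter \<open>m\<close>, where the
    two points on a sphere of radius \<open>\<rho>\<close> merge; the plane through them and the origin then tends to the
    plane of \<open>d m\<close> and the velocity there, so these two must be independent.\<close>
  obtain m where m: "0 < m" "m < 1" and velocity: "d m \<times> vector_derivative d (at m) \<noteq> 0"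
    using exists_nonradial_velocity[OF diff v(1) indep] by blast
  have d_nz: "d s \<noteq> 0" if "0 < s" "s < 1" for s
    using v(1)[OF that] by auto
  have cont_d: "continuous_on UNIV d"
    using diff differentiable_imp_continuous_within continuous_at_imp_continuous_on by blast
  \<comment> \<open>The curve divided by \<open>s * (1 - s)\<close>, written by partial fractions so that it extends
    continuously and without zeros to both end points: its directions form a compact arc.\<close>
  define Q where "Q = (\<lambda>a D s. if s = a then D else (d s - d a) /\<^sub>R (s - a))"
  have Q: "continuous_on UNIV (Q a D)" if "(d has_vector_derivative D) (at a)" for a D
    unfolding Q_def by (rule continuous_difference_quotient[OF diff that])
  define e where "e = (\<lambda>s. Q 0 D s - Q 1 D s)"
  have e: "continuous_on S e" for S
    unfolding e_def using Q[OF D(1)] Q[OF D(2)]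
    by (auto intro: continuous_on_diff continuous_on_subset)
  have e_ends: "e 0 = D" "e 1 = - D"
    by (simp_all add: e_def Q_def ends)
  have d_e: "d s = (s * (1 - s)) *\<^sub>R e s" if "s \<in> {0..1}" for s
  proof (cases "s = 0 \<or> s = 1")
    case False
    then have "e s = (1 / s - 1 / (s - 1)) *\<^sub>R d s"
      by (simp add: e_def Q_def ends scaleR_left_diff_distrib divide_inverse)
    also have "1 / s - 1 / (s - 1) = 1 / (s * (1 - s))"
      using False by (simp add: field_simps)
    finally show ?thesis using False by simp
  qed (auto simp: ends)
  have e_nz: "e s \<noteq> 0" if "s \<in> {0..1}" for s
    using d_e[OF that] d_nz[of s] that D(3) e_ends
    by (cases "s = 0"; cases "s = 1") auto
  have v_e: "0 < v \<bullet> sgn (e s)" if "0 < s" "s < 1" for s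
  proof -
    have "0 < (s * (1 - s)) * (v \<bullet> e s)"
      using v(1)[OF that] d_e[of s] that by simp
    moreover have "0 < s * (1 - s)" using that by simp
    ultimately have "0 < v \<bullet> e s" by (metis zero_less_mult_pos)
    then show ?thesis using e_nz[of s] that by (simp add: sgn_div_norm)
  qed
  have v_D: "v \<bullet> sgn D = 0" by (simp add: sgn_div_norm v(2))
  \<comment> \<open>The end directions are opposite and orthogonal to \<open>v\<close>, all others lie in the open half-space.\<close>
  have distinct: "sgn (e s) \<noteq> sgn (e t)" if st: "s \<in> {0..1}" "t \<in> {0..1}" "s < t" for s t
  proof
    assume eq: "sgn (e s) = sgn (e t)"
    consider "s = 0" "t = 1" | "s = 0" "t < 1" | "0 < s" "t = 1" | "0 < s" "t < 1"
      using st by fastforce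
    then show False
    proof cases
      case 1
      then have "sgn D = - sgn D" using eq by (simp add: e_ends sgn_minus)
      then have "2 *\<^sub>R sgn D = 0" unfolding scaleR_2 by (metis add.right_inverse)
      then show False using D(3) by (simp add: sgn_zero_iff)
    next
      case 2 then show False using v_e[of t] v_D eq st by (simp add: e_ends)
    next
      case 3 then show False using v_e[of s] v_D eq st by (simp add: e_ends sgn_minus)
    next
      case 4
      have pol: "d r = ((r * (1 - r)) * norm (e r)) *\<^sub>R sgn (e r)" if "r \<in> {0..1}" for r
        using d_e[OF that] e_nz[OF that] by (simp add: sgn_div_norm)
      have "d s \<times> d t = 0"
        using pol[OF st(1)] pol[OF st(2)] eq by (simp add: cross_mult_left cross_mult_right)
      then show False using indep 4 st by blast
    qed
  qed
  \<comment> \<open>With this \<open>\<kappa>\<close> the new distance \<open>s * (1 - s) * \<kappa> s\<close> from the origin is the tent function rising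
    linearly from 0 at 0 to 1 at \<open>m\<close> and falling linearly to 0 at 1, while \<open>\<kappa>\<close> stays positive and
    continuous at the end points.\<close>
  define \<kappa> where "\<kappa> = (\<lambda>s. 1 / max (m * (1 - s)) ((1 - m) * s))"
  have max_pos: "0 < max (m * (1 - s)) ((1 - m) * s)" if "s \<in> {0..1}" for s
    using m that by (cases "s = 1") (auto simp: less_max_iff_disj)
  obtain g g' where g: "homeomorphism UNIV UNIV g g'"
    and g_e: "\<And>s c. s \<in> {0..1} \<Longrightarrow> 0 \<le> c \<Longrightarrow> g (c *\<^sub>R e s) = (c * \<kappa> s) *\<^sub>R sgn (e s)"
  proof (rule radial_rescaling_of_compact_arc)
    show "inj_on (\<lambda>s. sgn (e s)) {0..1}"
      by (rule linorder_inj_onI) (use distinct in auto)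
    show "continuous_on {0..1} \<kappa>"
      unfolding \<kappa>_def using max_pos by (intro continuous_intros) force
    show "0 < \<kappa> s" if "s \<in> {0..1}" for s
      using max_pos[OF that] by (simp add: \<kappa>_def)
  qed (use e e_nz in auto)
  have g_d: "g (d s) = (s * (1 - s) * \<kappa> s) *\<^sub>R sgn (d s)" if "s \<in> {0..1}" for s
  proof (cases "s = 0 \<or> s = 1")
    case False
    then have "sgn (d s) = sgn (e s)"
      using d_e[OF that] that by (simp add: sgn_scaleR sgn_mult)
    moreover have "g (d s) = (s * (1 - s) * \<kappa> s) *\<^sub>R sgn (e s)"
      using d_e[OF that] g_e[OF that, of "s * (1 - s)"] that by simp
    ultimately show ?thesis by simp
  qed (use g_e[of 0 0] in \<open>auto simp: ends\<close>)

  \<comment> \<open>The two parameters at which the tent function takes the value \<open>\<rho>\<close>. Cutting \<open>\<rho>\<close> off at 1 makes the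
    rotation constant on and outside the unit sphere.\<close>
  define a where "a = (\<lambda>\<rho>. min \<rho> 1 * m)"
  define b where "b = (\<lambda>\<rho>. 1 - min \<rho> 1 * (1 - m))"
  have ab: "0 < a \<rho>" "a \<rho> \<le> m" "m \<le> b \<rho>" "b \<rho> < 1" if "0 < \<rho>" for \<rho>
  proof -
    have "0 < min \<rho> 1" "min \<rho> 1 \<le> 1" using that by auto
    then show "0 < a \<rho>" "a \<rho> \<le> m" "b \<rho> < 1"
      using m by (auto simp: a_def b_def mult_le_cancel_right1)
    have "b \<rho> - m = (1 - min \<rho> 1) * (1 - m)" by (simp add: b_def algebra_simps)
    also have "\<dots> \<ge> 0" using m by (intro mult_nonneg_nonneg) auto
    finally show "m \<le> b \<rho>" by simp
  qed
  let ?V = "vector_derivative d (at m)"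
  \<comment> \<open>The chord between the two points divided by \<open>1 - \<rho>\<close>. Since \<open>m\<close> divides the parameter interval
    between them in the fixed ratio \<open>m : (1 - m)\<close>, this is a fixed convex combination of
    difference quotients at \<open>m\<close>, hence converges to the velocity as \<open>\<rho>\<close> tends to 1.\<close>
  define \<Delta> where "\<Delta> = (\<lambda>\<rho>. m *\<^sub>R Q m ?V (a \<rho>) + (1 - m) *\<^sub>R Q m ?V (b \<rho>))"
  have QV: "continuous_on UNIV (Q m ?V)"
    using Q diff vector_derivative_works by blast
  have \<Delta>: "continuous_on S \<Delta>" for S
    unfolding \<Delta>_def a_def b_def by (intro continuous_intros continuous_on_compose2[OF QV]) auto
  have \<Delta>_chord: "(1 - \<rho>) *\<^sub>R \<Delta> \<rho> = d (b \<rho>) - d (a \<rho>)" if "0 < \<rho>" "\<rho> < 1" for \<rho>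
  proof -
    have Q_chord: "(s - m) *\<^sub>R Q m ?V s = d s - d m" for s by (simp add: Q_def)
    have am: "(1 - \<rho>) * m = - (a \<rho> - m)" and bm: "(1 - \<rho>) * (1 - m) = b \<rho> - m"
      using that by (auto simp: a_def b_def algebra_simps)
    have "(1 - \<rho>) *\<^sub>R \<Delta> \<rho> = ((1 - \<rho>) * m) *\<^sub>R Q m ?V (a \<rho>) + ((1 - \<rho>) * (1 - m)) *\<^sub>R Q m ?V (b \<rho>)"
      by (simp add: \<Delta>_def scaleR_add_right)
    also have "\<dots> = d (b \<rho>) - d (a \<rho>)"
      unfolding am bm scaleR_minus_left Q_chord by simp
    finally show ?thesis .
  qed
  define u where "u = (\<lambda>\<rho>. sgn (d (a \<rho>)))"
  define N where "N = (\<lambda>\<rho>. d (a \<rho>) \<times> \<Delta> \<rho>)"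
  have N_nz: "N \<rho> \<noteq> 0" if "0 < \<rho>" for \<rho>
  proof (cases "\<rho> < 1")
    case True
    have lt: "a \<rho> < b \<rho>" using True that m by (auto simp: a_def b_def algebra_simps)
    have "(1 - \<rho>) *\<^sub>R N \<rho> = d (a \<rho>) \<times> d (b \<rho>)"
      using \<Delta>_chord[OF that True]
      by (simp add: N_def flip: cross_mult_right) (simp add: Cross3.right_diff_distrib)
    then show ?thesis using indep[OF ab(1)[OF that] lt ab(4)[OF that]] by auto
  next
    case False
    then have "N \<rho> = d m \<times> ?V"
      by (simp add: N_def \<Delta>_def a_def b_def Q_def flip: scaleR_add_left)
    then show ?thesis using velocity by simp
  qed
  \<comment> \<open>On the sphere of radius \<open>\<rho>\<close>, rotate the normal \<open>N \<rho>\<close> of the plane through the origin and the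
    two points to the third coordinate axis.\<close>
  define R :: "real \<Rightarrow> real^3^3" where "R = (\<lambda>\<rho>. vector [u \<rho>, sgn (N \<rho>) \<times> u \<rho>, sgn (N \<rho>)])"
  have da_nz: "d (a \<rho>) \<noteq> 0" if "0 < \<rho>" for \<rho>
    using d_nz[of "a \<rho>"] ab[OF that] m by auto
  have cont_da: "continuous_on S (\<lambda>\<rho>. d (a \<rho>))" for S
    unfolding a_def by (intro continuous_intros continuous_on_compose2[OF cont_d]) auto
  have cont_u: "continuous_on {0<..} u"
    unfolding u_def sgn_div_norm using da_nz by (intro continuous_intros cont_da) auto
  have cont_n: "continuous_on {0<..} (\<lambda>\<rho>. sgn (N \<rho>))"
    unfolding sgn_div_norm using N_nz unfolding N_def
    by (intro continuous_intros continuous_on_cross cont_da \<Delta>) auto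
  have R: "homeomorphism UNIV UNIV (\<lambda>x. R (norm x) *v x) (\<lambda>x. transpose (R (norm x)) *v x)"
  proof (rule homeomorphism_rotating_spheres)
    show "continuous_on {0<..} R"
      unfolding R_def by (intro continuous_on_vector_3 continuous_on_cross cont_u cont_n)
    show "orthogonal_matrix (R \<rho>)" if "0 < \<rho>" for \<rho>
      unfolding R_def using da_nz[OF that] N_nz[OF that]
      by (intro orthogonal_matrix_frame)
        (simp_all add: u_def norm_sgn, simp add: N_def sgn_div_norm dot_cross_self)
  qed
  have normal: "N \<rho> \<bullet> d (a \<rho>) = 0" "N \<rho> \<bullet> d (b \<rho>) = 0" if "0 < \<rho>" "\<rho> \<le> 1" for \<rho>
  proof -
    show *: "N \<rho> \<bullet> d (a \<rho>) = 0" by (simp add: N_def dot_cross_self inner_commute)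
    show "N \<rho> \<bullet> d (b \<rho>) = 0"
    proof (cases "\<rho> < 1")
      case True
      have "N \<rho> \<bullet> (d (b \<rho>) - d (a \<rho>)) = 0"
        unfolding \<Delta>_chord[OF that(1) True, symmetric] by (simp add: N_def dot_cross_self)
      then show ?thesis using * by (simp add: inner_diff_right)
    next
      case False
      then have "b \<rho> = a \<rho>" using that by (simp add: a_def b_def)
      then show ?thesis using * by simp
    qed
  qed
  have flat: "(R (norm (g (d s))) *v g (d s)) $ 3 = 0" if "s \<in> {0..1}" for s
  proof (cases "s = 0 \<or> s = 1")
    case True
    then show ?thesis using g_d[OF that] by auto
  next
    case False
    define r where "r = s * (1 - s) * \<kappa> s"
    have r: "r = (if s \<le> m then s / m else (1 - s) / (1 - m))"
      using m that False by (auto simp: r_def \<kappa>_def max_def field_simps)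
    have "0 < r" "r \<le> 1" and ab_r: "s = a r \<or> s = b r"
      using m that False by (auto simp: r a_def b_def field_simps)
    have "norm (g (d s)) = r"
      using g_d[OF that] d_nz[of s] False that \<open>0 < r\<close> by (simp add: norm_sgn flip: r_def)
    moreover have "N r \<bullet> d s = 0" using normal[OF \<open>0 < r\<close> \<open>r \<le> 1\<close>] ab_r by metis
    ultimately show ?thesis
      using g_d[OF that]
      by (simp add: matrix_vector_mul_component R_def sgn_div_norm)
  qed
  show thesis
    using that[OF homeomorphism_compose[OF g R]] flat by simp
qed

section \<open>Knots without trisecants\<close>

text \<open>The derivatives at both ends agree, so the two branches of the knot leave \<open>p\<close> in opposite
  directions.\<close>

lemma knot_parametrisation_from_point:
  assumes K: "smooth_knot K" and p: "p \<in> K"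
  obtains \<gamma> D where "\<And>t. \<gamma> differentiable (at t)"
    and "(\<gamma> has_vector_derivative D) (at 0)" "(\<gamma> has_vector_derivative D) (at 1)" "D \<noteq> 0"
    and "\<gamma> 0 = p" "\<gamma> 1 = p" "inj_on \<gamma> {0..<1}" "\<gamma> ` {0..1} = K" "\<And>t. \<gamma> t \<in> K"
proof -
  obtain f where f: "smooth_circle_embedding f" and Kf: "K = f ` sphere 0 1"
    using K by (auto simp: smooth_knot_def)
  define G where "G = (\<lambda>t. f (cis t))"
  have inj: "inj_on f (sphere 0 1)" and G'_nz: "vector_derivative G (at t) \<noteq> 0"
    and smooth: "smooth_curve G" for t
    using f by (auto simp: smooth_circle_embedding_def G_def)
  have G: "G differentiable (at t)" for t
    using smooth[unfolded smooth_curve_def, rule_format, of 0 t]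
    by (simp add: nth_vector_derivative_def)
  obtain z where "z \<in> sphere 0 1" "p = f z" using p Kf by auto
  then obtain \<alpha> where \<alpha>: "p = G \<alpha>"
    unfolding G_def by (metis cis_Arg mem_sphere_0 norm_zero zero_neq_one sgn_div_norm scaleR_one inverse_1)
  have cis_eq: "cis x = cis y \<longleftrightarrow> (\<exists>n::int. x = y + 2 * pi * n)" for x y
    using sin_cos_eq_iff[of x y] by (auto simp: complex_eq_iff)
  define \<gamma> where "\<gamma> = (\<lambda>t. G (\<alpha> + 2 * pi * t))"
  have der: "(\<gamma> has_vector_derivative (2 * pi) *\<^sub>R vector_derivative G (at (\<alpha> + 2 * pi * t))) (at t)" for t
  proof -
    have "((\<lambda>t. \<alpha> + 2 * pi * t) has_vector_derivative 2 * pi) (at t)"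
      by (auto intro!: derivative_eq_intros simp: has_real_derivative_iff_has_vector_derivative[symmetric])
    from vector_diff_chain_at[OF this] G vector_derivative_works show ?thesis
      unfolding \<gamma>_def o_def by blast
  qed
  have per: "\<gamma> (t - 1) = \<gamma> t" for t
    unfolding \<gamma>_def G_def
    by (rule arg_cong[of _ _ f]) (auto simp: cis_eq algebra_simps intro!: exI[of _ "-1"])
  let ?D = "(2 * pi) *\<^sub>R vector_derivative G (at \<alpha>)"
  have D0: "(\<gamma> has_vector_derivative ?D) (at 0)" using der[of 0] by simp
  have "((\<lambda>t::real. t - 1) has_vector_derivative 1) (at 1)"
    by (auto intro!: derivative_eq_intros simp: has_real_derivative_iff_has_vector_derivative[symmetric])
  from vector_diff_chain_at[OF this, of \<gamma> ?D] D0
  have D1: "(\<gamma> has_vector_derivative ?D) (at 1)" by (simp add: o_def per)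
  have inK: "\<gamma> t \<in> K" for t by (simp add: \<gamma>_def G_def Kf)
  have "inj_on \<gamma> {0..<1}"
  proof (rule inj_onI)
    fix s t :: real assume st: "s \<in> {0..<1}" "t \<in> {0..<1}" and eq: "\<gamma> s = \<gamma> t"
    then have "cis (\<alpha> + 2 * pi * s) = cis (\<alpha> + 2 * pi * t)"
      using inj by (auto simp: \<gamma>_def G_def dest: inj_onD)
    then obtain n :: int where "2 * pi * s = 2 * pi * (t + n)"
      by (auto simp: cis_eq algebra_simps)
    then have "s = t + n" by simp
    moreover from this have "n = 0" using st by auto
    ultimately show "s = t" by simp
  qed
  moreover have "K \<subseteq> \<gamma> ` {0..1}"
  proof
    fix x assume "x \<in> K"
    then obtain w where "norm w = 1" "x = f w" using Kf by auto
    then obtain \<beta> where \<beta>: "x = G \<beta>"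
      unfolding G_def by (metis cis_Arg norm_zero zero_neq_one sgn_div_norm scaleR_one inverse_1)
    define c where "c = (\<beta> - \<alpha>) / (2 * pi)"
    then have "2 * pi * c = \<beta> - \<alpha>" by simp
    then have "\<alpha> + 2 * pi * frac c = \<beta> + 2 * pi * real_of_int (- \<lfloor>c\<rfloor>)"
      by (simp add: frac_def algebra_simps)
    then have "cis (\<alpha> + 2 * pi * frac c) = cis \<beta>" unfolding cis_eq by blast
    then have "x = \<gamma> (frac c)" by (simp add: \<gamma>_def G_def \<beta>)
    then show "x \<in> \<gamma> ` {0..1}" using frac_ge_0 frac_lt_1 less_imp_le by (metis atLeastAtMost_iff imageI)
  qed
  ultimately show thesis
    using D0 D1 der G'_nz inK per[of 1]
    by (intro that[of \<gamma> ?D]) (auto simp: \<gamma>_def \<alpha> intro: differentiableI_vector)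
qed

lemma affine_plane_third_coordinate: "affine_plane {x :: real^3. x $ 3 = 0}"
proof -
  have "{x :: real^3. x $ 3 = 0} = {x. axis 3 1 \<bullet> x = 0}"
    by (simp add: inner_axis')
  then show ?thesis
    by (simp add: affine_plane_def affine_hyperplane aff_dim_hyperplane axis_eq_0_iff)
qed

text \<open>Both points lie strictly on the same side of a plane through \<open>p\<close>, so if they were aligned
  with \<open>p\<close> the nearer one would lie between \<open>p\<close> and the other.\<close>

lemma not_parallel_if_not_aligned:
  fixes p x y v :: "real^3"
  assumes "0 < v \<bullet> (x - p)" "0 < v \<bullet> (y - p)" "x \<noteq> y"
    and "x \<notin> open_segment p y" "y \<notin> open_segment p x"
  shows "(x - p) \<times> (y - p) \<noteq> 0"
proof
  assume "(x - p) \<times> (y - p) = 0"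
  moreover have "x \<noteq> p" "y \<noteq> p" using assms by auto
  ultimately obtain k where k: "y - p = k *\<^sub>R (x - p)" by (auto elim: parallel_imp_scaled)
  then have "0 < k" using assms(1,2) by (simp add: zero_less_mult_iff)
  have y: "y = (1 - k) *\<^sub>R p + k *\<^sub>R x" using k by (simp add: algebra_simps)
  have "k \<noteq> 1" using y \<open>x \<noteq> y\<close> by auto
  then consider "k < 1" | "1 < k" by linarith
  then show False
  proof cases
    case 1 then show False
      using assms(5) y \<open>0 < k\<close> \<open>x \<noteq> p\<close> by (auto simp: in_segment)
  next
    case 2
    have "x - p = (1 / k) *\<^sub>R (y - p)" using k \<open>0 < k\<close> by simp
    then have "x = (1 - 1 / k) *\<^sub>R p + (1 / k) *\<^sub>R y" by (simp add: algebra_simps)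
    moreover have "0 < 1 / k" "1 / k < 1" using 2 by simp_all
    ultimately show False
      using assms(4) \<open>y \<noteq> p\<close> unfolding in_segment by metis
  qed
qed

theorem theorem1p6:
  fixes K :: "(real^3) set"
  assumes "smooth_knot K"
    and "nontrivial_knot K"
  shows "\<exists>a\<in>K. \<exists>p\<in>K. \<exists>b\<in>K.
           a \<noteq> p \<and> p \<noteq> b \<and> a \<noteq> b \<and> p \<in> open_segment a b"
proof (rule ccontr)
  assume "\<not> ?thesis"
  then have no_trisecant: "y \<notin> open_segment x z"
    if "x \<in> K" "y \<in> K" "z \<in> K" "x \<noteq> y" "y \<noteq> z" "x \<noteq> z" for x y z
    using that by blast
  obtain f where "smooth_circle_embedding f" "K = f ` sphere 0 1"
    using assms(1) by (auto simp: smooth_knot_def)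
  then have "f 1 \<in> K" by simp
  then have "K \<noteq> {}" by blast
  moreover have "compact K"
  proof -
    obtain \<gamma> :: "real \<Rightarrow> real^3" where "\<And>t. \<gamma> differentiable (at t)" "\<gamma> ` {0..1} = K"
      using knot_parametrisation_from_point[OF assms(1) \<open>f 1 \<in> K\<close>] by metis
    then show ?thesis
      by (metis compact_continuous_image compact_Icc continuous_at_imp_continuous_on
          differentiable_imp_continuous_within)
  qed
  ultimately obtain p where "p \<in> K" and far: "\<And>x. x \<in> K \<Longrightarrow> norm x \<le> norm p"
    using continuous_attains_sup[of K norm] continuous_on_norm_id by blast
  obtain \<gamma> D where diff: "\<And>t. \<gamma> differentiable (at t)"
    and D: "(\<gamma> has_vector_derivative D) (at 0)" "(\<gamma> has_vector_derivative D) (at 1)" "D \<noteq> 0"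
    and ends: "\<gamma> 0 = p" "\<gamma> 1 = p" and inj: "inj_on \<gamma> {0..<1}"
    and image: "\<gamma> ` {0..1} = K" and inK: "\<And>t. \<gamma> t \<in> K"
    using knot_parametrisation_from_point[OF assms(1) \<open>p \<in> K\<close>] by metis
  have side: "0 < - p \<bullet> (x - p)" if "x \<in> K" "x \<noteq> p" for x
  proof -
    have "0 < (x - p) \<bullet> (x - p)" using that by simp
    moreover have "x \<bullet> x \<le> p \<bullet> p" using far[OF that(1)] by (simp add: norm_le)
    ultimately show ?thesis by (simp add: inner_diff inner_commute)
  qed
  have ne: "\<gamma> s \<noteq> \<gamma> t" if "0 \<le> s" "s < t" "t < 1" for s t
    using inj that by (auto dest!: inj_onD)
  have ne_p: "\<gamma> s \<noteq> p" if "0 < s" "s < 1" for s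
    using ne[of 0 s] that ends by auto
  let ?d = "\<lambda>t. \<gamma> t - p"
  \<comment> \<open>The knot touches its supporting plane at \<open>p\<close>.\<close>
  have tangent: "- p \<bullet> D = 0"
  proof (rule DERIV_local_min)
    show "((\<lambda>t. - p \<bullet> \<gamma> t) has_real_derivative - p \<bullet> D) (at 0)"
      using D(1) unfolding has_vector_derivative_def has_field_derivative_def
      by (auto intro!: derivative_eq_intros)
    show "\<forall>t. \<bar>0 - t\<bar> < 1 \<longrightarrow> - p \<bullet> \<gamma> 0 \<le> - p \<bullet> \<gamma> t"
    proof (intro allI impI)
      fix t
      show "- p \<bullet> \<gamma> 0 \<le> - p \<bullet> \<gamma> t"
        using side[OF inK, of t] ends(1) by (cases "\<gamma> t = p") (simp_all add: inner_diff_right)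
    qed
  qed simp
  obtain h h' :: "real^3 \<Rightarrow> real^3"
    where h: "homeomorphism UNIV UNIV h h'" "\<And>s. s \<in> {0..1} \<Longrightarrow> h (?d s) $ 3 = 0"
  proof (rule fan_curve_flattens)
    show "?d differentiable (at t)" for t using diff by simp
    show "(?d has_vector_derivative D) (at 0)" "(?d has_vector_derivative D) (at 1)"
      using D by (auto intro!: derivative_eq_intros)
    show "0 < - p \<bullet> ?d s" if "0 < s" "s < 1" for s
      using side inK ne_p that by blast
    show "?d s \<times> ?d t \<noteq> 0" if "0 < s" "s < t" "t < 1" for s t
      using that ne[of s t] ne_p[of s] ne_p[of t] side inK \<open>p \<in> K\<close>
      by (intro not_parallel_if_not_aligned[of "- p"] no_trisecant) auto
  qed (use D(3) ends tangent in auto)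
  have "homeomorphism UNIV UNIV (h \<circ> (+) (- p)) ((+) p \<circ> h')"
    using homeomorphism_compose[OF _ h(1)] homeomorphism_translation[of p UNIV] by simp
  moreover have "(h \<circ> (+) (- p)) ` K \<subseteq> {x. x $ 3 = 0}"
    using h(2) by (auto simp flip: image)
  ultimately show False
    using assms(2) affine_plane_third_coordinate unfolding nontrivial_knot_def by blast
qed

end
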